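(* Let $\mathcal{B}$ be a bounding family on $[n]^d$, $\mathcal{P}=\mathcal{P}(\mathcal{B})$, and $\mathcal{D}=\prod_{r=1}^d\mathcal{D}_r$ a product distribution on $[n]^d$. Then for every function $f:[n]^d\to\mathbb{R}$, $$\sum_{r=1}^d\mathrm{dist}^r_{\mathcal{D}}(f,\mathcal{P})\ \ge\ \frac{\mathrm{dist}_{\mathcal{D}}(f,\mathcal{P})}{4}.$$
   Context: A bounding family is a tuple of $2d$ functions $l_1,u_1,\dots,l_d,u_d:[n-1]\to\mathbb{R}$ with $l_r(y)<u_r(y)$. $\mathcal{P}(\mathcal{B})$ is the set of $f:[n]^d\to\mathbb{R}$ with $l_r(x_r)\le f(x+\mathbf{e}_r)-f(x)\le u_r(x_r)$ for all $r$ and $x$ with $x_r<n$. $\mathrm{dist}_{\mathcal{D}}(f,\mathcal{P})=\inf_{g\in\mathcal{P}}\Pr_{x\sim\mathcal{D}}[f(x)\ne g(x)]$. An $r$-line is a set $\{x\in[n]^d: x_j=a_j\ \forall j\ne r\}$ for fixed $(a_j)_{j\ne r}$; the distribution $\mathcal{D}_{-r}=\prod_{i\ne r}\mathcal{D}_i$ is thus a distribution on $r$-lines. For an $r$-line $\ell$, $f|_\ell:[n]\to\mathbb{R}$ is the restriction, and $\mathrm{dist}_{\mathcal{D}_r}(f|_\ell,\mathcal{P})$ is its distance (w.r.t. $\mathcal{D}_r$) to the one-dimensional property $\{g:[n]\to\mathbb{R}: l_r(t)\le g(t+1)-g(t)\le u_r(t)\ \forall t\in[n-1]\}$. Define $\mathrm{dist}^r_{\mathcal{D}}(f,\mathcal{P})=\mathbb{E}_{\ell\sim\mathcal{D}_{-r}}[\mathrm{dist}_{\mathcal{D}_r}(f|_\ell,\mathcal{P})]$.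 *)

theory Defs
  imports Complex_Main "HOL-Library.FuncSet"
begin

text \<open>Conventions: [n] = {1..n}; coordinates are indexed by r \<in> {0..<d}.
  Points of [n]^d are extensional functions in PiE {..<d} (\<lambda>_. {1..n}).
  A product distribution D = prod_r D_r is given by weights p r t (t \<in> [n]),
  nonnegative and summing to 1 for each r < d.\<close>

definition grid :: "nat \<Rightarrow> nat \<Rightarrow> (nat \<Rightarrow> nat) set" where
  "grid n d = PiE {..<d} (\<lambda>_. {1..n})"

definition is_bounding_family ::
  "nat \<Rightarrow> nat \<Rightarrow> (nat \<Rightarrow> nat \<Rightarrow> real) \<Rightarrow> (nat \<Rightarrow> nat \<Rightarrow> real) \<Rightarrow> bool" where
  "is_bounding_family n d l u \<longleftrightarrow> (\<forall>r<d. \<forall>y\<in>{1..n-1}. l r y < u r y)"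

definition is_product_dist :: "nat \<Rightarrow> nat \<Rightarrow> (nat \<Rightarrow> nat \<Rightarrow> real) \<Rightarrow> bool" where
  "is_product_dist n d p \<longleftrightarrow>
     (\<forall>r<d. (\<forall>t\<in>{1..n}. 0 \<le> p r t) \<and> (\<Sum>t\<in>{1..n}. p r t) = 1)"

definition propP ::
  "nat \<Rightarrow> nat \<Rightarrow> (nat \<Rightarrow> nat \<Rightarrow> real) \<Rightarrow> (nat \<Rightarrow> nat \<Rightarrow> real) \<Rightarrow> ((nat \<Rightarrow> nat) \<Rightarrow> real) set" where
  "propP n d l u = {g. \<forall>r<d. \<forall>x\<in>grid n d. x r < n \<longrightarrow>
       l r (x r) \<le> g (x(r := x r + 1)) - g x \<and> g (x(r := x r + 1)) - g x \<le> u r (x r)}"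

definition disagree ::
  "nat \<Rightarrow> nat \<Rightarrow> (nat \<Rightarrow> nat \<Rightarrow> real) \<Rightarrow> ((nat \<Rightarrow> nat) \<Rightarrow> real) \<Rightarrow> ((nat \<Rightarrow> nat) \<Rightarrow> real) \<Rightarrow> real" where
  "disagree n d p f g = (\<Sum>x\<in>grid n d. (\<Prod>r<d. p r (x r)) * (if f x \<noteq> g x then 1 else 0))"

definition distD ::
  "nat \<Rightarrow> nat \<Rightarrow> (nat \<Rightarrow> nat \<Rightarrow> real) \<Rightarrow> (nat \<Rightarrow> nat \<Rightarrow> real) \<Rightarrow> (nat \<Rightarrow> nat \<Rightarrow> real)
     \<Rightarrow> ((nat \<Rightarrow> nat) \<Rightarrow> real) \<Rightarrow> real" where
  "distD n d l u p f = Inf ((\<lambda>g. disagree n d p f g) ` propP n d l u)"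

definition propP1 ::
  "nat \<Rightarrow> (nat \<Rightarrow> nat \<Rightarrow> real) \<Rightarrow> (nat \<Rightarrow> nat \<Rightarrow> real) \<Rightarrow> nat \<Rightarrow> (nat \<Rightarrow> real) set" where
  "propP1 n l u r = {g. \<forall>t\<in>{1..n-1}. l r t \<le> g (t + 1) - g t \<and> g (t + 1) - g t \<le> u r t}"

definition dist1 ::
  "nat \<Rightarrow> (nat \<Rightarrow> nat \<Rightarrow> real) \<Rightarrow> (nat \<Rightarrow> nat \<Rightarrow> real) \<Rightarrow> (nat \<Rightarrow> nat \<Rightarrow> real) \<Rightarrow> nat
     \<Rightarrow> (nat \<Rightarrow> real) \<Rightarrow> real" where
  "dist1 n l u p r h =
     Inf ((\<lambda>g. \<Sum>t\<in>{1..n}. p r t * (if h t \<noteq> g t then 1 else 0)) ` propP1 n l u r)"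

text \<open>dist^r_D(f,P) = E_{line ~ D_{-r}} [dist_{D_r}(f|_line, P)]; a line is given
  by the coordinates a j (j \<noteq> r), and f|_line t = f (a(r := t)).\<close>
definition distr ::
  "nat \<Rightarrow> nat \<Rightarrow> (nat \<Rightarrow> nat \<Rightarrow> real) \<Rightarrow> (nat \<Rightarrow> nat \<Rightarrow> real) \<Rightarrow> (nat \<Rightarrow> nat \<Rightarrow> real)
     \<Rightarrow> nat \<Rightarrow> ((nat \<Rightarrow> nat) \<Rightarrow> real) \<Rightarrow> real" where
  "distr n d l u p r f =
     (\<Sum>a\<in>PiE ({..<d} - {r}) (\<lambda>_. {1..n}).
        (\<Prod>i\<in>{..<d} - {r}. p i (a i)) * dist1 n l u p r (\<lambda>t. f (a(r := t))))"

end

theory Submission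
  imports Defs "HOL-Analysis.Function_Topology"
begin

text \<open>For a set \<open>S\<close> of directions let \<open>best w S e f\<close> be the least value of
  \<open>\<Sum>x. w x * dist (f x - h x, [0, e])\<close> over all \<open>h\<close> satisfying the constraints in the directions
  in \<open>S\<close>, and let \<open>gain w S e f = best w S 0 f - best w S e f\<close>. By duality, for small \<open>e > 0\<close> the
  quotient \<open>gain / e\<close> is the size of a maximum-weight fractional matching in the graph of violated
  pairs that differ only in directions in \<open>S\<close>; the argument below stays on the dual side and never
  mentions matchings. Three facts give the theorem.

  \<^item> Take an \<open>L\<^sup>1\<close>-closest \<open>h\<close> and let \<open>e\<close> be smaller than all nonzero values of \<open>\<bar>f - h\<bar>\<close>. The two
    competitors \<open>h\<close> and \<open>h - e\<close> save \<open>e\<close> wherever \<open>f > h\<close> and wherever \<open>f < h\<close>, respectively, so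
    \<open>2 * gain \<ge> e * dist\<close> for \<open>S\<close> the set of all directions.
  \<^item> The gain is \<open>e\<close>-Lipschitz in \<open>f\<close> for the weighted Hamming distance, by uncrossing a minimizer
    for \<open>e\<close> with one for \<open>0\<close>.
  \<^item> If \<open>f\<close> has no violation in direction \<open>r \<notin> S\<close>, then adding \<open>r\<close> to \<open>S\<close> leaves the gain
    unchanged: minimizers on consecutive slices can be uncrossed so as to respect direction \<open>r\<close>.

  Repairing all \<open>r\<close>-lines of \<open>f\<close> costs \<open>dist\<^sup>r\<close>, and is paid twice to pass from \<open>S\<close> to
  \<open>insert r S\<close>. Adding the directions one at a time yields
  \<open>e * dist \<le> 2 * gain \<le> 4 * e * (\<Sum>r. dist\<^sup>r)\<close>.\<close>

section \<open>Exchange inequalities on the real line\<close>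

definition seg_dist :: "real \<Rightarrow> real \<Rightarrow> real" where
  "seg_dist e z = max 0 (max (- z) (z - e))"

lemma seg_dist_nonneg [simp]: "0 \<le> seg_dist e z"
  by (simp add: seg_dist_def)

text \<open>\<open>seg_dist e (y - h)\<close> is the distance from \<open>y\<close> to the interval
  [h, h + e]. Clamping \<open>h'\<close> into [h, h + e] and \<open>h\<close> into [h' - e, h'] puts
  the new point inside the old interval and the old point inside the new interval, so the exchange
  costs at most \<open>e\<close>. If \<open>y = y'\<close> it is free: the terms swap exactly when
  \<open>h'\<close> lies in [h, h + e], and otherwise the distance to an endpoint minus the distance
  to the interval is monotone.\<close>

lemma seg_dist_transport_le:
  assumes "e \<ge> 0"
  shows "seg_dist 0 (y - max h (min h' (h + e))) + seg_dist e (y' - max (h' - e) (min h h'))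
    \<le> seg_dist e (y - h) + seg_dist 0 (y' - h') + e * (if y \<noteq> y' then 1 else 0)"
proof -
  consider "h' \<le> h" | "h \<le> h'" "h' \<le> h + e" | "h + e \<le> h'" by linarith
  then show ?thesis
  proof cases
    case 1
    then have "max h (min h' (h + e)) = h" "max (h' - e) (min h h') = h'"
      using assms by auto
    then show ?thesis using 1 assms unfolding seg_dist_def by (auto simp: max_def)
  next
    case 2
    then have "max h (min h' (h + e)) = h'" "max (h' - e) (min h h') = h"
      using assms by auto
    then show ?thesis using 2 assms unfolding seg_dist_def by (auto simp: max_def)
  next
    case 3
    then have "max h (min h' (h + e)) = h + e" "max (h' - e) (min h h') = h' - e"
      using assms by auto
    then show ?thesis using 3 assms unfolding seg_dist_def by (auto simp: max_def)
  qed
qed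

text \<open>As \<open>y\<close> lies in [g - C, g + C], clamping moves \<open>h\<close> towards
  \<open>y\<close> without passing it, and \<open>seg_dist e\<close> is monotone on either side of
  0.\<close>

lemma seg_dist_clamp_le:
  assumes "e \<ge> 0" "\<bar>y - g\<bar> \<le> C"
  shows "seg_dist e (y - max (g - C) (min h (g + C))) \<le> seg_dist e (y - h)"
  using assms unfolding seg_dist_def by (auto simp: max_def min_def)

text \<open>A Monge inequality for the convex function \<open>seg_dist e\<close>: after shifting by
  the violated bound, the two values of \<open>f\<close> and the two values of \<open>h\<close> are
  in opposite order, and exchanging the latter does not raise the sum.\<close>

lemma seg_dist_uncross_le:
  assumes "a \<le> b" "a \<le> y' - y" "y' - y \<le> b"
  shows "seg_dist e (y - max (h' - b) (min h (h' - a))) + seg_dist e (y' - max (h + a) (min h' (h + b)))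
    \<le> seg_dist e (y - h) + seg_dist e (y' - h')"
proof -
  consider "h' - h < a" | "a \<le> h' - h" "h' - h \<le> b" | "b < h' - h" by linarith
  then show ?thesis
  proof cases
    case 1
    then have "max (h' - b) (min h (h' - a)) = h' - a" "max (h + a) (min h' (h + b)) = h + a"
      using assms by auto
    then show ?thesis using 1 assms unfolding seg_dist_def by (auto simp: max_def)
  next
    case 2
    then have "max (h' - b) (min h (h' - a)) = h" "max (h + a) (min h' (h + b)) = h'"
      using assms by auto
    then show ?thesis by simp
  next
    case 3
    then have "max (h' - b) (min h (h' - a)) = h' - b" "max (h + a) (min h' (h + b)) = h + b"
      using assms by auto
    then show ?thesis using 3 assms unfolding seg_dist_def by (auto simp: max_def)
  qed
qed

section \<open>Lines of the grid, product weights and a compact box\<close>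

lemma finite_grid [simp]: "finite (grid n d)"
  unfolding grid_def by (intro finite_PiE) auto

lemma grid_upd: "x \<in> grid n d \<Longrightarrow> r < d \<Longrightarrow> t \<in> {1..n} \<Longrightarrow> x(r := t) \<in> grid n d"
  unfolding grid_def by (auto simp: PiE_iff extensional_def)

lemma grid_range: "x \<in> grid n d \<Longrightarrow> r < d \<Longrightarrow> x r \<in> {1..n}"
  unfolding grid_def by (auto simp: PiE_iff)

lemma grid_sum_lines:
  fixes F :: "(nat \<Rightarrow> nat) \<Rightarrow> real"
  assumes "r < d"
  shows "(\<Sum>x\<in>grid n d. F x)
    = (\<Sum>t\<in>{1..n}. \<Sum>a\<in>PiE ({..<d} - {r}) (\<lambda>_. {1..n}). F (a(r := t)))"
proof -
  let ?A = "PiE ({..<d} - {r}) (\<lambda>_. {1..n})"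
  have g: "grid n d = (\<lambda>(y, a). a(r := y)) ` ({1..n} \<times> ?A)"
    using PiE_insert_eq[of r "{..<d} - {r}" "\<lambda>_. {1..n}"] assms
    by (simp add: grid_def insert_absorb)
  have i: "inj_on (\<lambda>(y, a). a(r := y)) ({1..n} \<times> ?A)"
    using inj_combinator[of r "{..<d} - {r}" "\<lambda>_. {1..n}"] by simp
  show ?thesis
    unfolding g sum.reindex[OF i] sum.cartesian_product by (simp add: case_prod_unfold)
qed

lemma line_point_in_grid:
  assumes "r < d" "a \<in> PiE ({..<d} - {r}) (\<lambda>_. {1..n})" "t \<in> {1..n}"
  shows "a(r := t) \<in> grid n d"
  using assms unfolding grid_def by (auto simp: PiE_iff extensional_def)

lemma prod_line:
  fixes p :: "nat \<Rightarrow> nat \<Rightarrow> real"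
  assumes "r < d"
  shows "(\<Prod>i<d. p i ((a(r := t)) i)) = p r t * (\<Prod>i\<in>{..<d} - {r}. p i (a i))"
proof -
  have "(\<Prod>i<d. p i ((a(r := t)) i))
      = p r t * (\<Prod>i\<in>{..<d} - {r}. p i ((a(r := t)) i))"
    using prod.remove[of "{..<d}" r "\<lambda>i. p i ((a(r := t)) i)"] assms by simp
  also have "(\<Prod>i\<in>{..<d} - {r}. p i ((a(r := t)) i)) = (\<Prod>i\<in>{..<d} - {r}. p i (a i))"
    by (intro prod.cong) auto
  finally show ?thesis .
qed

lemma compact_box_fun:
  fixes g c :: "'a \<Rightarrow> real"
  shows "compact {h. \<forall>x. g x - c x \<le> h x \<and> h x \<le> g x + c x}"
proof -
  have "compactin (product_topology (\<lambda>x. euclidean) UNIV) (PiE UNIV (\<lambda>x. {g x - c x..g x + c x}))"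
    by (subst compactin_PiE) simp
  moreover have "PiE UNIV (\<lambda>x. {g x - c x..g x + c x}) = {h. \<forall>x. g x - c x \<le> h x \<and> h x \<le> g x + c x}"
    by (auto simp: PiE_iff)
  ultimately show ?thesis
    by (simp add: euclidean_product_topology)
qed

section \<open>Functions satisfying some of the constraints, and the cheapest among them\<close>

locale bounding_grid =
  fixes n d :: nat and l u :: "nat \<Rightarrow> nat \<Rightarrow> real"
  assumes bounding: "is_bounding_family n d l u"
begin

lemma l_le_u: "x \<in> grid n d \<Longrightarrow> r < d \<Longrightarrow> x r < n \<Longrightarrow> l r (x r) \<le> u r (x r)"
  using bounding grid_range[of x n d r] unfolding is_bounding_family_def
  by (intro less_imp_le) auto

definition PS :: "nat set \<Rightarrow> ((nat \<Rightarrow> nat) \<Rightarrow> real) set" where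
  "PS S = {g. \<forall>r\<in>S. \<forall>x\<in>grid n d. x r < n \<longrightarrow>
       l r (x r) \<le> g (x(r := x r + 1)) - g x \<and> g (x(r := x r + 1)) - g x \<le> u r (x r)}"

definition cost :: "((nat \<Rightarrow> nat) \<Rightarrow> real) \<Rightarrow> real \<Rightarrow> ((nat \<Rightarrow> nat) \<Rightarrow> real) \<Rightarrow> ((nat \<Rightarrow> nat) \<Rightarrow> real) \<Rightarrow> real" where
  "cost w e f h = (\<Sum>x\<in>grid n d. w x * seg_dist e (f x - h x))"

definition best where
  "best w S e f = Inf (cost w e f ` PS S)"

lemma propP_eq_PS: "propP n d l u = PS {..<d}"
  unfolding propP_def PS_def by auto

lemma PS_mono: "S \<subseteq> T \<Longrightarrow> PS T \<subseteq> PS S"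
  unfolding PS_def by blast

lemma PS_Un: "PS (S \<union> T) = PS S \<inter> PS T"
  unfolding PS_def by blast

text \<open>All clamps below are built from max, min and constant shifts; closure under these keeps
  the uncrossed functions feasible.\<close>

lemma PS_max:
  assumes "g \<in> PS S" "h \<in> PS S"
  shows "(\<lambda>x. max (g x) (h x)) \<in> PS S"
  unfolding PS_def
proof (intro CollectI ballI impI)
  fix r x assume x: "r \<in> S" "x \<in> grid n d" "x r < n"
  let ?y = "x(r := x r + 1)"
  have "l r (x r) \<le> g ?y - g x" "g ?y - g x \<le> u r (x r)"
      "l r (x r) \<le> h ?y - h x" "h ?y - h x \<le> u r (x r)"
    using assms x unfolding PS_def by blast+
  then show "l r (x r) \<le> max (g ?y) (h ?y) - max (g x) (h x)
      \<and> max (g ?y) (h ?y) - max (g x) (h x) \<le> u r (x r)"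
    unfolding max_def by (simp split: if_splits)
qed

lemma PS_min:
  assumes "g \<in> PS S" "h \<in> PS S"
  shows "(\<lambda>x. min (g x) (h x)) \<in> PS S"
  unfolding PS_def
proof (intro CollectI ballI impI)
  fix r x assume x: "r \<in> S" "x \<in> grid n d" "x r < n"
  let ?y = "x(r := x r + 1)"
  have "l r (x r) \<le> g ?y - g x" "g ?y - g x \<le> u r (x r)"
      "l r (x r) \<le> h ?y - h x" "h ?y - h x \<le> u r (x r)"
    using assms x unfolding PS_def by blast+
  then show "l r (x r) \<le> min (g ?y) (h ?y) - min (g x) (h x)
      \<and> min (g ?y) (h ?y) - min (g x) (h x) \<le> u r (x r)"
    unfolding min_def by (simp split: if_splits)
qed

lemma PS_add: "g \<in> PS S \<Longrightarrow> (\<lambda>x. g x + c) \<in> PS S"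
  unfolding PS_def by auto

lemma PS_diff: "g \<in> PS S \<Longrightarrow> (\<lambda>x. g x - c) \<in> PS S"
  unfolding PS_def by auto

lemma PS_nonempty:
  assumes "S \<subseteq> {..<d}"
  obtains g where "g \<in> PS S"
proof -
  \<comment> \<open>Prefix sums of the lower bounds, so that a unit step in direction
    \<open>r\<close> adds exactly \<open>l r (x r)\<close>.\<close>
  define g where "g = (\<lambda>x. \<Sum>r<d. \<Sum>t<x r. l r t)"
  have "g (x(r := x r + 1)) - g x = l r (x r)" if "r < d" for x r
  proof -
    have "g y = (\<Sum>t<y r. l r t) + (\<Sum>i\<in>{..<d} - {r}. \<Sum>t<y i. l i t)" for y
      unfolding g_def using that by (subst sum.remove[of _ r]) auto
    note this[of x] this[of "x(r := x r + 1)"]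
    moreover have "(\<Sum>i\<in>{..<d} - {r}. \<Sum>t<(x(r := x r + 1)) i. l i t)
        = (\<Sum>i\<in>{..<d} - {r}. \<Sum>t<x i. l i t)"
      by (intro sum.cong) auto
    ultimately show ?thesis by simp
  qed
  then have "g \<in> PS S"
    unfolding PS_def using assms l_le_u by auto
  then show thesis by (rule that)
qed

lemma PS_cong:
  assumes "g \<in> PS S" "S \<subseteq> {..<d}" "\<And>x. x \<in> grid n d \<Longrightarrow> g x = h x"
  shows "h \<in> PS S"
proof -
  have "x(r := x r + 1) \<in> grid n d" if "x \<in> grid n d" "r \<in> S" "x r < n" for x r
    using that assms(2) by (intro grid_upd) auto
  then show ?thesis
    using assms(1) unfolding PS_def by (auto simp flip: assms(3))
qed

text \<open>Any competitor can be clamped to within \<open>C\<close> of a fixed feasible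
  \<open>g\<close> at no extra cost, since \<open>C\<close> bounds the distance from
  \<open>f\<close> to \<open>g\<close> on the grid. Hence a minimum over the compact box
  \<open>K\<close> is global.\<close>

lemma cost_attains:
  assumes S: "S \<subseteq> {..<d}" and w: "\<And>x. x \<in> grid n d \<Longrightarrow> 0 \<le> w x" and e: "e \<ge> 0"
  obtains h where "h \<in> PS S" "\<And>k. k \<in> PS S \<Longrightarrow> cost w e f h \<le> cost w e f k"
proof -
  obtain g where g: "g \<in> PS S" using PS_nonempty[OF S] .
  define C where "C = (\<Sum>x\<in>grid n d. \<bar>f x - g x\<bar>)"
  define c where "c = (\<lambda>x. if x \<in> grid n d then C else 0)"
  have C: "\<bar>f x - g x\<bar> \<le> C" if "x \<in> grid n d" for x
    unfolding C_def using that by (intro member_le_sum) auto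
  have "C \<ge> 0" unfolding C_def by (intro sum_nonneg) auto
  then have c0: "c x \<ge> 0" for x by (simp add: c_def)
  define K where "K = {h. \<forall>x. g x - c x \<le> h x \<and> h x \<le> g x + c x}"
  have coord: "continuous_on A (\<lambda>h. h x)" for A and x :: "nat \<Rightarrow> nat"
    by (rule continuous_on_product_coordinates[THEN continuous_on_subset]) simp
  have "PS S = (\<Inter>r\<in>S. \<Inter>x\<in>{x\<in>grid n d. x r < n}.
      {h. l r (x r) \<le> h (x(r := x r + 1)) - h x} \<inter> {h. h (x(r := x r + 1)) - h x \<le> u r (x r)})"
    unfolding PS_def by auto
  also have "closed \<dots>"
    by (intro closed_INT closed_Int ballI closed_Collect_le continuous_intros coord)
  finally have "compact (K \<inter> PS S)"
    unfolding K_def by (intro compact_Int_closed compact_box_fun)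
  moreover have "g \<in> K \<inter> PS S"
    using g c0 by (auto simp: K_def)
  moreover have "continuous_on (K \<inter> PS S) (cost w e f)"
    unfolding cost_def seg_dist_def by (intro continuous_intros coord)
  ultimately obtain h where h: "h \<in> K \<inter> PS S" "\<And>k. k \<in> K \<inter> PS S \<Longrightarrow> cost w e f h \<le> cost w e f k"
    using continuous_attains_inf[of "K \<inter> PS S" "cost w e f"] by auto
  have "cost w e f h \<le> cost w e f k" if k: "k \<in> PS S" for k
  proof -
    define k' where "k' = (\<lambda>x. max (g x - c x) (min (k x) (g x + c x)))"
    have "(\<lambda>x. max (g x - C) (min (k x) (g x + C))) \<in> PS S"
      by (intro PS_max PS_min PS_add PS_diff g k)
    then have "k' \<in> PS S"
      by (rule PS_cong) (auto simp: k'_def c_def S)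
    moreover have "k' \<in> K" using c0 using c0 by (auto simp: K_def k'_def max.coboundedI1 intro: order_trans)
    ultimately have "cost w e f h \<le> cost w e f k'" using h by blast
    also have "\<dots> \<le> cost w e f k"
      unfolding cost_def k'_def c_def
      by (intro sum_mono mult_left_mono w) (simp_all add: seg_dist_clamp_le[OF e C])
    finally show ?thesis .
  qed
  then show thesis using h that by blast
qed

lemma best_attained:
  assumes "S \<subseteq> {..<d}" "\<And>x. x \<in> grid n d \<Longrightarrow> 0 \<le> w x" "e \<ge> 0"
  obtains h where "h \<in> PS S" "best w S e f = cost w e f h"
proof -
  obtain h where "h \<in> PS S" "\<And>k. k \<in> PS S \<Longrightarrow> cost w e f h \<le> cost w e f k"
    using cost_attains[where w = w and e = e and f = f, OF assms] by blast
  then show thesis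
    by (intro that[of h]) (auto simp: best_def intro!: cInf_eq_minimum)
qed

lemma best_le:
  assumes "\<And>x. x \<in> grid n d \<Longrightarrow> 0 \<le> w x" "k \<in> PS S"
  shows "best w S e f \<le> cost w e f k"
  unfolding best_def
proof (intro cINF_lower bdd_belowI2[where m = 0])
  show "0 \<le> cost w e f h" for h
    unfolding cost_def using assms(1) by (intro sum_nonneg mult_nonneg_nonneg) auto
qed (rule assms(2))

section \<open>The gain and its Lipschitz dependence on \<open>f\<close>\<close>

definition gain where
  "gain w S e f = best w S 0 f - best w S e f"

lemma gain_diff_le:
  assumes S: "S \<subseteq> {..<d}" and w: "\<And>x. x \<in> grid n d \<Longrightarrow> 0 \<le> w x" and e: "e \<ge> 0"
  shows "gain w S e f - gain w S e f' \<le> e * (\<Sum>x\<in>grid n d. w x * (if f x \<noteq> f' x then 1 else 0))"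
proof -
  obtain h where h: "h \<in> PS S" "best w S e f = cost w e f h"
    using best_attained[where w = w and e = e and f = f, OF S w e] by blast
  obtain h' where h': "h' \<in> PS S" "best w S 0 f' = cost w 0 f' h'"
    using best_attained[where w = w and e = 0 and f = f', OF S w order_refl] by blast
  \<comment> \<open>\<open>k\<close> competes for width 0 and \<open>f\<close>, \<open>k'\<close>
    for width \<open>e\<close> and \<open>f'\<close>: the two minima with positive sign in the
    difference of the gains.\<close>
  define k where "k = (\<lambda>x. max (h x) (min (h' x) (h x + e)))"
  define k' where "k' = (\<lambda>x. max (h' x - e) (min (h x) (h' x)))"
  have "k \<in> PS S" "k' \<in> PS S"
    unfolding k_def k'_def by (intro PS_max PS_min PS_add PS_diff h h')+
  then have "best w S 0 f \<le> cost w 0 f k" "best w S e f' \<le> cost w e f' k'"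
    by (auto intro: best_le w)
  moreover have "cost w 0 f k + cost w e f' k' \<le> cost w e f h + cost w 0 f' h'
      + e * (\<Sum>x\<in>grid n d. w x * (if f x \<noteq> f' x then 1 else 0))"
    unfolding cost_def sum_distrib_left sum.distrib[symmetric]
  proof (rule sum_mono)
    fix x assume x: "x \<in> grid n d"
    have "seg_dist 0 (f x - k x) + seg_dist e (f' x - k' x) \<le> seg_dist e (f x - h x)
      + seg_dist 0 (f' x - h' x) + e * (if f x \<noteq> f' x then 1 else 0)"
      unfolding k_def k'_def by (rule seg_dist_transport_le[OF e])
    from mult_left_mono[OF this w[OF x]]
    show "w x * seg_dist 0 (f x - k x) + w x * seg_dist e (f' x - k' x)
      \<le> w x * seg_dist e (f x - h x) + w x * seg_dist 0 (f' x - h' x)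
        + e * (w x * (if f x \<noteq> f' x then 1 else 0))"
      by (simp add: algebra_simps)
  qed
  ultimately show ?thesis
    unfolding gain_def using h h' by linarith
qed

lemma gain_empty: "(\<And>x. x \<in> grid n d \<Longrightarrow> 0 \<le> w x) \<Longrightarrow> e \<ge> 0 \<Longrightarrow> gain w {} e f = 0"
proof -
  assume w: "\<And>x. x \<in> grid n d \<Longrightarrow> 0 \<le> w x" and e: "e \<ge> 0"
  have "best w {} e f = 0" if e: "e \<ge> 0" for e
  proof -
    have "cost w e f f = 0" using e by (simp add: cost_def seg_dist_def)
    moreover have "0 \<le> cost w e f k" for k
      unfolding cost_def using w by (intro sum_nonneg mult_nonneg_nonneg) auto
    moreover obtain h where "best w {} e f = cost w e f h"
      using best_attained[of "{}" w e f] w e by blast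
    moreover have "f \<in> PS {}" by (simp add: PS_def)
    ultimately show ?thesis using best_le[of w f "{}" e f] w by (metis order_antisym)
  qed
  then show ?thesis using e by (simp add: gain_def)
qed

section \<open>Adding a direction in which \<open>f\<close> has no violation\<close>

definition slice_mix :: "nat \<Rightarrow> nat \<Rightarrow> ((nat \<Rightarrow> nat) \<Rightarrow> real) \<Rightarrow> ((nat \<Rightarrow> nat) \<Rightarrow> real) \<Rightarrow> (nat \<Rightarrow> nat) \<Rightarrow> real" where
  "slice_mix r t g h = (\<lambda>x. if x r = t then g x else h x)"

text \<open>A step in a direction of \<open>S\<close> never leaves its \<open>r\<close>-slice, so
  different slices can be chosen independently.\<close>

lemma PS_glue:
  assumes "\<And>t. g t \<in> PS S" "r \<notin> S"
  shows "(\<lambda>x. g (x r) x) \<in> PS S"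
proof -
  have "(x(i := x i + 1)) r = x r" if "i \<in> S" for x :: "nat \<Rightarrow> nat" and i
    using that assms(2) by auto
  then show ?thesis using assms(1) unfolding PS_def by (simp del: fun_upd_apply)
qed

lemma PS_slice_mix: "g \<in> PS S \<Longrightarrow> h \<in> PS S \<Longrightarrow> r \<notin> S \<Longrightarrow> slice_mix r t g h \<in> PS S"
  using PS_glue[of "\<lambda>s. if s = t then g else h" S r] by (simp add: slice_mix_def if_distrib if_distribR)

text \<open>The bounds in direction \<open>i\<close> depend on \<open>x i\<close> alone, so slice
  \<open>t\<close> may be copied to every other slice.\<close>

lemma PS_shift:
  assumes "g \<in> PS S" "r \<notin> S" "r < d" "t \<in> {1..n}"
  shows "(\<lambda>x. g (x(r := t))) \<in> PS S"
  unfolding PS_def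
proof (intro CollectI ballI impI)
  fix i x assume i: "i \<in> S" and x: "x \<in> grid n d" and xi: "x i < n"
  have "i \<noteq> r" using assms i by auto
  then have "(x(i := x i + 1))(r := t) = (x(r := t))(i := (x(r := t)) i + 1)" "(x(r := t)) i = x i"
    by (auto simp: fun_upd_twist)
  note e = this
  let ?z = "x(r := t)"
  have "?z \<in> grid n d" using x assms by (intro grid_upd)
  moreover have "?z i < n" using xi \<open>i \<noteq> r\<close> by simp
  ultimately have "l i (?z i) \<le> g (?z(i := ?z i + 1)) - g ?z \<and> g (?z(i := ?z i + 1)) - g ?z \<le> u i (?z i)"
    using assms(1) i unfolding PS_def by blast
  then show "l i (x i) \<le> g ((x(i := x i + 1))(r := t)) - g (x(r := t))
      \<and> g ((x(i := x i + 1))(r := t)) - g (x(r := t)) \<le> u i (x i)"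
    unfolding e .
qed

context
  fixes r :: nat and S :: "nat set" and \<omega> f :: "(nat \<Rightarrow> nat) \<Rightarrow> real" and e :: real
  assumes r: "r < d" "r \<notin> S" and S: "S \<subseteq> {..<d}" and e: "e \<ge> 0"
    and f: "f \<in> PS {r}"
    and \<omega>_nonneg: "\<And>x. x \<in> grid n d \<Longrightarrow> 0 \<le> \<omega> x" and \<omega>_upd: "\<And>x t. \<omega> (x(r := t)) = \<omega> x"
begin

definition slice_cost :: "nat \<Rightarrow> ((nat \<Rightarrow> nat) \<Rightarrow> real) \<Rightarrow> real" where
  "slice_cost t h = (\<Sum>a\<in>PiE ({..<d} - {r}) (\<lambda>_. {1..n}).
      \<omega> a * seg_dist e (f (a(r := t)) - h (a(r := t))))"

text \<open>Optimality is required on every slice, even on slices of weight \<open>q t = 0\<close>: the uncrossing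
  step compares neighbouring slices with equal weights.\<close>

definition slice_optimal :: "((nat \<Rightarrow> nat) \<Rightarrow> real) \<Rightarrow> bool" where
  "slice_optimal h \<longleftrightarrow> h \<in> PS S \<and> (\<forall>t\<in>{1..n}. \<forall>k\<in>PS S. slice_cost t h \<le> slice_cost t k)"

lemma cost_slices:
  assumes "\<And>x. w x = q (x r) * \<omega> x"
  shows "cost w e f h = (\<Sum>t\<in>{1..n}. q t * slice_cost t h)"
  unfolding cost_def slice_cost_def grid_sum_lines[OF r(1)]
  by (simp add: assms \<omega>_upd sum_distrib_left mult.assoc)

lemma slice_optimal_exists: "\<exists>h. slice_optimal h"
proof -
  have "\<exists>h. h \<in> PS S \<and> (t \<in> {1..n} \<longrightarrow> (\<forall>k\<in>PS S. slice_cost t h \<le> slice_cost t k))" for t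
  proof -
    \<comment> \<open>With this weight \<open>cost\<close> sees slice \<open>t\<close> only; the
      minimizers for the individual slices are glued afterwards.\<close>
    define w where "w = (\<lambda>x. (if x r = t then 1 else 0) * \<omega> x)"
    have "cost w e f h = slice_cost t h" if "t \<in> {1..n}" for h
      using that by (subst cost_slices[of w "\<lambda>s. if s = t then 1 else 0"]) (simp_all add: w_def if_distrib[of "\<lambda>z. z * _"] cong: if_cong)
    moreover have "w x \<ge> 0" if "x \<in> grid n d" for x
      using \<omega>_nonneg[OF that] by (simp add: w_def)
    then obtain h where "h \<in> PS S" "\<And>k. k \<in> PS S \<Longrightarrow> cost w e f h \<le> cost w e f k"
      using cost_attains[where w = w and e = e and f = f, OF S _ e] by blast
    ultimately show ?thesis by auto
  qed
  then obtain G where G: "\<And>t. G t \<in> PS S"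
      "\<And>t k. t \<in> {1..n} \<Longrightarrow> k \<in> PS S \<Longrightarrow> slice_cost t (G t) \<le> slice_cost t k"
    by metis
  have "slice_cost t (\<lambda>x. G (x r) x) = slice_cost t (G t)" for t
    by (simp add: slice_cost_def)
  then have "slice_optimal (\<lambda>x. G (x r) x)"
    unfolding slice_optimal_def using G PS_glue[of G S r] r by auto
  then show ?thesis by blast
qed

text \<open>\<open>A\<close> and \<open>B\<close> uncross slices \<open>t\<close> and
  \<open>t + 1\<close> without raising their joint cost. As \<open>h\<close> is already optimal on
  slice \<open>t\<close>, \<open>A\<close> saves nothing there, so \<open>B\<close> costs no more
  than \<open>h\<close> on slice \<open>t + 1\<close>. Slice \<open>t\<close> can therefore stay as
  it is.\<close>

lemma slice_optimal_step:
  assumes h: "slice_optimal h" and t: "1 \<le> t" "t < n"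
  defines "B \<equiv> \<lambda>y. max (h (y(r := t)) + l r t) (min (h y) (h (y(r := t)) + u r t))"
  shows "slice_optimal (slice_mix r (t + 1) B h)"
proof -
  define A where "A = (\<lambda>x. max (h (x(r := t + 1)) - u r t) (min (h x) (h (x(r := t + 1)) - l r t)))"
  have hS: "h \<in> PS S" using h by (simp add: slice_optimal_def)
  have sh: "(\<lambda>x. h (x(r := t))) \<in> PS S" "(\<lambda>x. h (x(r := t + 1))) \<in> PS S"
    using t by (intro PS_shift hS r; simp)+
  have "A \<in> PS S" "B \<in> PS S"
    unfolding A_def B_def by (intro PS_max PS_min PS_add PS_diff hS sh)+
  have "slice_cost t A + slice_cost (t + 1) B \<le> slice_cost t h + slice_cost (t + 1) h"
    unfolding slice_cost_def sum.distrib[symmetric]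
  proof (rule sum_mono)
    fix a assume a: "a \<in> PiE ({..<d} - {r}) (\<lambda>_. {1..n})"
    let ?x = "a(r := t)" and ?y = "a(r := t + 1)"
    have x: "?x \<in> grid n d" using a t by (intro line_point_in_grid r) auto
    have "0 \<le> \<omega> a" using \<omega>_nonneg[OF x] by (simp only: \<omega>_upd)
    have lu: "l r t \<le> u r t" using l_le_u[OF x r(1)] t by simp
    \<comment> \<open>The absence of violations of \<open>f\<close> in direction \<open>r\<close>
      enters here.\<close>
    have fx: "l r t \<le> f ?y - f ?x" "f ?y - f ?x \<le> u r t"
      using f x t unfolding PS_def by fastforce+
    from mult_left_mono[OF seg_dist_uncross_le[OF lu fx, where e = e and h = "h ?x" and h' = "h ?y"] \<open>0 \<le> \<omega> a\<close>]
    show "\<omega> a * seg_dist e (f ?x - A ?x) + \<omega> a * seg_dist e (f ?y - B ?y)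
      \<le> \<omega> a * seg_dist e (f ?x - h ?x) + \<omega> a * seg_dist e (f ?y - h ?y)"
      by (simp add: A_def B_def distrib_left)
  qed
  moreover have "slice_cost t h \<le> slice_cost t A"
    using h t \<open>A \<in> PS S\<close> unfolding slice_optimal_def by auto
  ultimately have "slice_cost (t + 1) B \<le> slice_cost (t + 1) h" by linarith
  moreover have "slice_cost s (slice_mix r (t + 1) B h) = (if s = t + 1 then slice_cost s B else slice_cost s h)" for s
    by (simp add: slice_cost_def slice_mix_def)
  ultimately have "slice_cost s (slice_mix r (t + 1) B h) \<le> slice_cost s h" for s
    by simp
  moreover have "slice_mix r (t + 1) B h \<in> PS S"
    by (rule PS_slice_mix[OF \<open>B \<in> PS S\<close> hS r(2)])
  ultimately show ?thesis
    using h unfolding slice_optimal_def by (blast intro: order_trans)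
qed

text \<open>Sweep upwards: replacing slice \<open>m + 1\<close> leaves all lower slices alone, so
  constraints already restored persist, and the one towards slice \<open>m + 2\<close> is treated in
  the next round.\<close>

lemma slice_optimal_repaired: "\<exists>h. slice_optimal h \<and> h \<in> PS {r}"
proof -
  have "\<exists>h. slice_optimal h \<and> (\<forall>x\<in>grid n d. x r < m \<longrightarrow> x r < n \<longrightarrow>
      l r (x r) \<le> h (x(r := x r + 1)) - h x \<and> h (x(r := x r + 1)) - h x \<le> u r (x r))" for m
  proof (induction m)
    case 0
    show ?case using slice_optimal_exists by simp
  next
    case (Suc m)
    then obtain h where h: "slice_optimal h" and con: "\<And>x. x \<in> grid n d \<Longrightarrow> x r < m \<Longrightarrow> x r < n \<Longrightarrow>
      l r (x r) \<le> h (x(r := x r + 1)) - h x \<and> h (x(r := x r + 1)) - h x \<le> u r (x r)"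
      by blast
    show ?case
    proof (cases "1 \<le> m \<and> m < n")
      case False
      \<comment> \<open>Coordinates start at 1 and constraints start below \<open>n\<close>, so this
        round adds no new constraint.\<close>
      have "x r < m" if "x \<in> grid n d" "x r < Suc m" "x r < n" for x
        using False that grid_range[OF that(1) r(1)] by auto
      then show ?thesis using h con by blast
    next
      case True
      define B where "B = (\<lambda>y. max (h (y(r := m)) + l r m) (min (h y) (h (y(r := m)) + u r m)))"
      define h' where "h' = slice_mix r (m + 1) B h"
      have "slice_optimal h'"
        unfolding h'_def B_def using True by (intro slice_optimal_step h) auto
      moreover have "l r (x r) \<le> h' (x(r := x r + 1)) - h' x \<and> h' (x(r := x r + 1)) - h' x \<le> u r (x r)"
        if x: "x \<in> grid n d" "x r < Suc m" "x r < n" for x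
      proof (cases "x r = m")
        case True
        have "l r m \<le> u r m" using l_le_u[OF x(1) r(1) x(3)] True by simp
        moreover have "x(r := m) = x" using True by auto
        ultimately show ?thesis
          using True by (auto simp: h'_def slice_mix_def B_def)
      next
        case False
        then show ?thesis using con[OF x(1) _ x(3)] x(2) by (simp add: h'_def slice_mix_def)
      qed
      ultimately show ?thesis by blast
    qed
  qed
  from this[of n] show ?thesis unfolding PS_def by auto
qed

text \<open>The product form of the distribution matters here: the weights on the slices are
  proportional, so one function that is optimal on every slice is optimal for \<open>w\<close>, and
  a repaired one is feasible for direction \<open>r\<close> as well.\<close>

lemma best_insert:
  assumes w: "\<And>x. w x = q (x r) * \<omega> x" and q: "\<And>t. t \<in> {1..n} \<Longrightarrow> 0 \<le> q t"
  shows "best w (insert r S) e f = best w S e f"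
proof (rule antisym)
  have w0: "0 \<le> w x" if "x \<in> grid n d" for x
    using \<omega>_nonneg[OF that] q[OF grid_range[OF that r(1)]] by (simp add: w)
  obtain h where h: "slice_optimal h" "h \<in> PS {r}" using slice_optimal_repaired by blast
  then have hr: "h \<in> PS (insert r S)"
    using PS_Un[of "{r}" S] by (simp add: slice_optimal_def)
  obtain k where k: "k \<in> PS S" "best w S e f = cost w e f k"
    using best_attained[where w = w and e = e and f = f, OF S w0 e] by blast
  have "best w (insert r S) e f \<le> cost w e f h" using hr by (intro best_le w0)
  also have "\<dots> \<le> cost w e f k"
    unfolding cost_slices[OF w] using h k q
    by (intro sum_mono mult_left_mono) (auto simp: slice_optimal_def)
  finally show "best w (insert r S) e f \<le> best w S e f" using k by simp
  have "insert r S \<subseteq> {..<d}" using r S by auto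
  then obtain k' where k': "k' \<in> PS (insert r S)" "best w (insert r S) e f = cost w e f k'"
    using best_attained[where w = w and e = e and f = f, OF _ w0 e] by blast
  then have "k' \<in> PS S" using PS_mono[of S "insert r S"] by auto
  then show "best w S e f \<le> best w (insert r S) e f"
    using best_le[where w = w and e = e and f = f, OF w0] k'(2) by simp
qed

end

section \<open>Bounding the distance by the gain\<close>

lemma gain_lower_bound:
  assumes S: "S \<subseteq> {..<d}" and w: "\<And>x. x \<in> grid n d \<Longrightarrow> 0 \<le> w x"
  obtains e h where "e > 0" "h \<in> PS S"
    "e * (\<Sum>x\<in>grid n d. w x * (if f x \<noteq> h x then 1 else 0)) \<le> 2 * gain w S e f"
proof -
  obtain h where h: "h \<in> PS S" "best w S 0 f = cost w 0 f h"
    using best_attained[where w = w and e = 0 and f = f, OF S w order_refl] by blast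
  \<comment> \<open>The element 1 covers the case that \<open>f\<close> and \<open>h\<close> agree
    on the whole grid.\<close>
  define e where "e = Min (insert 1 ((\<lambda>x. \<bar>f x - h x\<bar>) ` {x\<in>grid n d. f x \<noteq> h x}))"
  have "e > 0" unfolding e_def by (subst Min_gr_iff) auto
  have gap: "e \<le> \<bar>f x - h x\<bar>" if "x \<in> grid n d" "f x \<noteq> h x" for x
    unfolding e_def using that by (intro Min_le) auto
  have "best w S e f \<le> cost w e f h" using h(1) by (intro best_le w)
  moreover have "best w S e f \<le> cost w e f (\<lambda>x. h x - e)"
    using PS_diff[OF h(1)] by (intro best_le w)
  moreover have "cost w e f h + cost w e f (\<lambda>x. h x - e)
      + e * (\<Sum>x\<in>grid n d. w x * (if f x \<noteq> h x then 1 else 0)) \<le> 2 * cost w 0 f h"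
    unfolding cost_def sum_distrib_left sum.distrib[symmetric]
  proof (rule sum_mono)
    fix x assume x: "x \<in> grid n d"
    have "seg_dist e (f x - h x) + seg_dist e (f x - (h x - e)) + e * (if f x \<noteq> h x then 1 else 0)
        \<le> 2 * seg_dist 0 (f x - h x)"
    proof (cases "f x" "h x" rule: linorder_cases)
      case less
      then have "seg_dist e (f x - h x) = h x - f x" "seg_dist e (f x - (h x - e)) = h x - f x - e"
          "seg_dist 0 (f x - h x) = h x - f x"
        using gap[OF x] \<open>e > 0\<close> by (auto simp: seg_dist_def)
      then show ?thesis using less by simp
    next
      case equal
      then show ?thesis using \<open>e > 0\<close> by (simp add: seg_dist_def)
    next
      case greater
      then have "seg_dist e (f x - h x) = f x - h x - e" "seg_dist e (f x - (h x - e)) = f x - h x"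
          "seg_dist 0 (f x - h x) = f x - h x"
        using gap[OF x] \<open>e > 0\<close> by (auto simp: seg_dist_def)
      then show ?thesis using greater by simp
    qed
    from mult_left_mono[OF this w[OF x]]
    show "w x * seg_dist e (f x - h x) + w x * seg_dist e (f x - (h x - e))
        + e * (w x * (if f x \<noteq> h x then 1 else 0)) \<le> 2 * (w x * seg_dist 0 (f x - h x))"
      by (simp add: algebra_simps)
  qed
  ultimately show thesis
    using that[OF \<open>e > 0\<close> h(1)] h(2) by (simp add: gain_def)
qed

section \<open>Repairing all lines in one direction, and its effect on the gain\<close>

lemma repair_lines:
  assumes p: "is_product_dist n d p" and r: "r < d" and "\<delta> > 0"
  obtains f' where "f' \<in> PS {r}" "disagree n d p f f' \<le> distr n d l u p r f + \<delta>"
proof -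
  let ?A = "PiE ({..<d} - {r}) (\<lambda>_. {1..n})"
  let ?\<omega> = "\<lambda>a. \<Prod>i\<in>{..<d} - {r}. p i (a i)"
  let ?c = "\<lambda>a g. \<Sum>t\<in>{1..n}. p r t * (if f (a(r := t)) \<noteq> g t then 1 else 0)"
  have \<omega>: "0 \<le> ?\<omega> a" if "a \<in> ?A" for a
    using p that unfolding is_product_dist_def by (intro prod_nonneg) (auto simp: PiE_iff)
  \<comment> \<open>\<open>dist1\<close> is an infimum, so each line gets a repair that is optimal
    up to \<open>\<delta>\<close>.\<close>
  have "\<exists>g\<in>propP1 n l u r. ?c a g \<le> dist1 n l u p r (\<lambda>t. f (a(r := t))) + \<delta>" for a
  proof -
    have "(\<lambda>t. \<Sum>i<t. l r i) \<in> propP1 n l u r"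
      using bounding r unfolding propP1_def is_bounding_family_def by (auto intro: less_imp_le)
    then have "?c a ` propP1 n l u r \<noteq> {}" by blast
    moreover have "Inf (?c a ` propP1 n l u r) < dist1 n l u p r (\<lambda>t. f (a(r := t))) + \<delta>"
      using \<open>\<delta> > 0\<close> by (simp add: dist1_def)
    ultimately have "\<exists>y\<in>?c a ` propP1 n l u r. y < dist1 n l u p r (\<lambda>t. f (a(r := t))) + \<delta>"
      by (rule cInf_lessD)
    then show ?thesis unfolding bex_simps(7) by (meson less_imp_le)
  qed
  then obtain G where G: "\<And>a. G a \<in> propP1 n l u r"
      "\<And>a. ?c a (G a) \<le> dist1 n l u p r (\<lambda>t. f (a(r := t))) + \<delta>"
    using bchoice[of UNIV "\<lambda>a g. g \<in> propP1 n l u r \<and> ?c a g \<le> dist1 n l u p r (\<lambda>t. f (a(r := t))) + \<delta>"]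
    by blast
  \<comment> \<open>The restriction names the line through \<open>x\<close> and is constant along
    it, so \<open>f'\<close> follows a single repair on each line.\<close>
  define f' where "f' = (\<lambda>x. G (restrict x ({..<d} - {r})) (x r))"
  have restrict_upd: "restrict (x(r := t)) ({..<d} - {r}) = restrict x ({..<d} - {r})" for x t
    by (auto simp: restrict_def)
  have "f' \<in> PS {r}"
    unfolding PS_def
  proof (intro CollectI ballI impI)
    fix i x assume "i \<in> {r}" and x: "x \<in> grid n d" "x i < n"
    then have "x r \<in> {1..n-1}" using grid_range[OF x(1) r] by auto
    then show "l i (x i) \<le> f' (x(i := x i + 1)) - f' x \<and> f' (x(i := x i + 1)) - f' x \<le> u i (x i)"
      using \<open>i \<in> {r}\<close> G(1) unfolding f'_def propP1_def by (auto simp: restrict_upd)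
  qed
  moreover have "disagree n d p f f' \<le> distr n d l u p r f + \<delta>"
  proof -
    have "disagree n d p f f' = (\<Sum>t\<in>{1..n}. \<Sum>a\<in>?A. ?\<omega> a * (p r t * (if f (a(r := t)) \<noteq> G a t then 1 else 0)))"
      unfolding disagree_def grid_sum_lines[OF r] prod_line[OF r]
    proof (intro sum.cong refl)
      fix t a assume "a \<in> ?A"
      then have "restrict a ({..<d} - {r}) = a" by (rule PiE_restrict)
      then have "f' (a(r := t)) = G a t" by (simp add: f'_def restrict_upd)
      then show "p r t * ?\<omega> a * (if f (a(r := t)) \<noteq> f' (a(r := t)) then 1 else 0)
        = ?\<omega> a * (p r t * (if f (a(r := t)) \<noteq> G a t then 1 else 0))"
        by simp
    qed
    also have "\<dots> = (\<Sum>a\<in>?A. ?\<omega> a * ?c a (G a))"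
      by (subst sum.swap) (simp add: sum_distrib_left)
    also have "\<dots> \<le> (\<Sum>a\<in>?A. ?\<omega> a * (dist1 n l u p r (\<lambda>t. f (a(r := t))) + \<delta>))"
      by (intro sum_mono mult_left_mono G \<omega>)
    also have "\<dots> = distr n d l u p r f + (\<Sum>a\<in>?A. ?\<omega> a) * \<delta>"
      by (simp add: distr_def distrib_left sum.distrib sum_distrib_right)
    \<comment> \<open>The line weights sum to 1, so the total slack is again
      \<open>\<delta>\<close>.\<close>
    also have "(\<Sum>a\<in>?A. ?\<omega> a) = (\<Prod>i\<in>{..<d} - {r}. \<Sum>t\<in>{1..n}. p i t)"
      by (rule prod_sum_PiE[symmetric]) auto
    also have "\<dots> = 1"
      using p unfolding is_product_dist_def by (intro prod.neutral) auto
    finally show ?thesis by simp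
  qed
  ultimately show thesis by (rule that)
qed

lemma gain_step:
  assumes p: "is_product_dist n d p" and r: "r < d" and e: "e \<ge> 0"
  defines "w \<equiv> \<lambda>x. \<Prod>i<d. p i (x i)"
  shows "gain w {..<Suc r} e f \<le> gain w {..<r} e f + 2 * e * distr n d l u p r f"
proof -
  have w0: "0 \<le> w x" if "x \<in> grid n d" for x
    using p grid_range[OF that] unfolding w_def is_product_dist_def by (intro prod_nonneg) auto
  have S: "{..<r} \<subseteq> {..<d}" "{..<Suc r} \<subseteq> {..<d}" using r by auto
  have "gain w {..<Suc r} e f \<le> gain w {..<r} e f + 2 * e * (distr n d l u p r f + \<delta>)" if "\<delta> > 0" for \<delta>
  proof -
    obtain f' where f': "f' \<in> PS {r}" "disagree n d p f f' \<le> distr n d l u p r f + \<delta>"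
      using repair_lines[OF p r \<open>\<delta> > 0\<close>] .
    define \<omega> where "\<omega> = (\<lambda>x. \<Prod>i\<in>{..<d} - {r}. p i (x i))"
    have w\<omega>: "w x = p r (x r) * \<omega> x" for x
      using prod_line[OF r, of p x "x r"] by (simp add: w_def \<omega>_def)
    have \<omega>0: "0 \<le> \<omega> x" if "x \<in> grid n d" for x
      using p grid_range[OF that] unfolding \<omega>_def is_product_dist_def by (intro prod_nonneg) auto
    have \<omega>_upd: "\<omega> (x(r := t)) = \<omega> x" for x t
      unfolding \<omega>_def by (intro prod.cong) auto
    have "best w (insert r {..<r}) e' f' = best w {..<r} e' f'" if "e' \<ge> 0" for e'
      using p r by (intro best_insert[where \<omega> = \<omega> and q = "p r"] S f' \<omega>0 \<omega>_upd w\<omega> that)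
        (auto simp: is_product_dist_def)
    then have "gain w {..<Suc r} e f' = gain w {..<r} e f'"
      using e by (simp add: gain_def lessThan_Suc)
    moreover have "disagree n d p f' f = disagree n d p f f'"
      unfolding disagree_def by (intro sum.cong) auto
    ultimately have "gain w {..<Suc r} e f \<le> gain w {..<r} e f + 2 * e * disagree n d p f f'"
      using gain_diff_le[where w = w and f = f and f' = f', OF S(2) w0 e]
        gain_diff_le[where w = w and f = f' and f' = f, OF S(1) w0 e]
      by (simp add: disagree_def w_def)
    also have "\<dots> \<le> gain w {..<r} e f + 2 * e * (distr n d l u p r f + \<delta>)"
      using e f'(2) by (simp add: mult_left_mono)
    finally show ?thesis .
  qed
  then have *: "gain w {..<Suc r} e f - gain w {..<r} e f - 2 * e * distr n d l u p r f \<le> 2 * e * \<delta>" if "\<delta> > 0" for \<delta>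
    using that by (simp add: algebra_simps)
  have "gain w {..<Suc r} e f - gain w {..<r} e f - 2 * e * distr n d l u p r f \<le> \<eta>" if "\<eta> > 0" for \<eta>
  proof -
    \<comment> \<open>The added 1 keeps the denominator positive when \<open>e = 0\<close>.\<close>
    have "\<eta> / (2 * e + 1) > 0" using e that by simp
    note *[OF this]
    also have "2 * e * (\<eta> / (2 * e + 1)) \<le> \<eta>"
      using e that by (simp add: field_simps)
    finally show ?thesis .
  qed
  then have "gain w {..<Suc r} e f - gain w {..<r} e f - 2 * e * distr n d l u p r f \<le> 0"
    by (rule field_le_epsilon) simp
  then show ?thesis by simp
qed

end

theorem theorem1p8:
  fixes n d :: nat and l u p :: "nat \<Rightarrow> nat \<Rightarrow> real" and f :: "(nat \<Rightarrow> nat) \<Rightarrow> real"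
  assumes "is_bounding_family n d l u"
    and "is_product_dist n d p"
  shows "(\<Sum>r<d. distr n d l u p r f) \<ge> distD n d l u p f / 4"
proof -
  interpret bounding_grid n d l u by unfold_locales (rule assms(1))
  define w where "w = (\<lambda>x :: nat \<Rightarrow> nat. \<Prod>i<d. p i (x i))"
  have w0: "0 \<le> w x" if "x \<in> grid n d" for x
    using assms(2) grid_range[OF that] unfolding w_def is_product_dist_def by (intro prod_nonneg) auto
  obtain e h where e: "e > 0" and h: "h \<in> PS {..<d}"
    and eh: "e * disagree n d p f h \<le> 2 * gain w {..<d} e f"
    using gain_lower_bound[where S = "{..<d}" and w = w and f = f, OF subset_refl w0]
    by (auto simp: disagree_def w_def)
  \<comment> \<open>The width \<open>e\<close> found for the full set of directions is kept fixed
    while they are added one at a time.\<close>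
  have "gain w {..<m} e f \<le> 2 * e * (\<Sum>r<m. distr n d l u p r f)" if "m \<le> d" for m
    using that
  proof (induction m)
    case 0
    show ?case using gain_empty[of w e f] w0 e by simp
  next
    case (Suc m)
    then show ?case
      using gain_step[OF assms(2), of m e f] e by (simp add: w_def distrib_left)
  qed
  then have "gain w {..<d} e f \<le> 2 * e * (\<Sum>r<d. distr n d l u p r f)" by simp
  then have "e * disagree n d p f h \<le> e * (4 * (\<Sum>r<d. distr n d l u p r f))"
    using eh by linarith
  then have "disagree n d p f h \<le> 4 * (\<Sum>r<d. distr n d l u p r f)"
    using e by simp
  moreover have "distD n d l u p f \<le> disagree n d p f h"
    unfolding distD_def propP_eq_PS
  proof (intro cINF_lower bdd_belowI2[where m = 0] h)
    show "0 \<le> disagree n d p f g" for g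
      unfolding disagree_def using w0 by (intro sum_nonneg mult_nonneg_nonneg) (auto simp: w_def)
  qed
  ultimately show ?thesis by simp
qed

end
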